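(* Let $f\in\mathbb{R}[x_1,\ldots,x_n]$ be a form (homogeneous polynomial) of degree $d\ge1$ and let $g\in\mathbb{R}[x_1,\ldots,x_n]$ be the polynomial $$g(\mathbf{x}):=f(\mathbf{x})\Bigl(1-\frac{d}{d+2}\|\mathbf{x}\|^2\Bigr),\qquad \mathbf{x}\in\mathbb{R}^n .$$ Then for every $\mathbf{x}\in\mathbb{S}^{n-1}$: $$\nabla g(\mathbf{x})=0\ \Leftrightarrow\ \nabla f(\mathbf{x})=d\,f(\mathbf{x})\,\mathbf{x}\ \Leftrightarrow\ \|\nabla f(\mathbf{x})\|^2=(d\,f(\mathbf{x}))^2 .$$ That is, all critical points of $g$ in $\mathbb{S}^{n-1}$ satisfy (FONC) for $f$ and, conversely, all points of $\mathbb{S}^{n-1}$ that satisfy (FONC) for $f$ are critical points of $g$.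
   Context: $\mathbb{S}^{n-1}$ is the Euclidean unit sphere in $\mathbb{R}^n$ and $\|\cdot\|$ the Euclidean norm. A point $\mathbf{x}\in\mathbb{S}^{n-1}$ satisfies (FONC) for $f$ if there is $\lambda\in\mathbb{R}$ with $\nabla f(\mathbf{x})+2\lambda\mathbf{x}=0$. *)

theory Defs
  imports "HOL-Analysis.Analysis" "HOL-Library.Poly_Mapping"
begin

text \<open>
  Polynomials with real coefficients in variables indexed by a finite type: finitely supported
  maps from exponent vectors to coefficients. The ring operations are those of
  \<^theory>\<open>HOL-Library.Poly_Mapping\<close> (convolution product).
\<close>

type_synonym 'n real_mpoly = "('n \<Rightarrow>\<^sub>0 nat) \<Rightarrow>\<^sub>0 real"

definition monom_fun :: "('n::finite \<Rightarrow>\<^sub>0 nat) \<Rightarrow> real ^ 'n \<Rightarrow> real" where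
  "monom_fun m x = (\<Prod>i\<in>UNIV. (x $ i) ^ Poly_Mapping.lookup m i)"

definition poly_fun :: "'n::finite real_mpoly \<Rightarrow> real ^ 'n \<Rightarrow> real" where
  "poly_fun p x = (\<Sum>m\<in>Poly_Mapping.keys p. Poly_Mapping.lookup p m * monom_fun m x)"

text \<open>As usual, the zero polynomial counts as a form of every degree.\<close>

definition is_form :: "nat \<Rightarrow> 'n::finite real_mpoly \<Rightarrow> bool" where
  "is_form d p \<longleftrightarrow> (\<forall>m\<in>Poly_Mapping.keys p. (\<Sum>i\<in>UNIV. Poly_Mapping.lookup m i) = d)"

text \<open>
  The gradient as a total function. It is meaningful only where \<^term>\<open>f\<close> is differentiable,
  which holds everywhere for polynomial functions (lemma \<open>gderiv_poly_fun\<close> below).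
\<close>

definition gradient :: "('a::real_inner \<Rightarrow> real) \<Rightarrow> 'a \<Rightarrow> 'a" where
  "gradient f x = (THE D. GDERIV f x :> D)"

text \<open>First-order necessary condition for optimizing \<^term>\<open>f\<close> over the unit sphere; it is only
  used at points \<^term>\<open>x\<close> of the unit sphere.\<close>

definition fonc :: "('a::real_inner \<Rightarrow> real) \<Rightarrow> 'a \<Rightarrow> bool" where
  "fonc f x \<longleftrightarrow> (\<exists>l::real. gradient f x + (2 * l) *\<^sub>R x = 0)"

lemma gradient_eq:
  assumes "GDERIV f x :> D"
  shows "gradient f x = D"
  unfolding gradient_def
proof (rule the_equality)
  show "GDERIV f x :> D" by (fact assms)
next
  fix E assume "GDERIV f x :> E"
  with assms have "(\<lambda>h. inner h E) = (\<lambda>h. inner h D)"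
    unfolding gderiv_def by (rule has_derivative_unique[symmetric])
  then show "E = D"
    by (metis inner_commute vector_eq_rdot)
qed

lemma gderiv_poly_fun: "GDERIV (poly_fun p) x :> gradient (poly_fun p) x"
proof -
  have "\<exists>f'. ((\<lambda>x. \<Prod>i\<in>UNIV. (x $ i) ^ Poly_Mapping.lookup m i) has_derivative f') (at x)"
    for m :: "'a \<Rightarrow>\<^sub>0 nat"
    by (rule exI, rule has_derivative_prod, rule has_derivative_power,
        rule bounded_linear.has_derivative[OF bounded_linear_vec_nth], rule has_derivative_ident)
  then have "monom_fun m differentiable (at x)" for m :: "'a \<Rightarrow>\<^sub>0 nat"
    unfolding monom_fun_def [abs_def] differentiable_def by blast
  then have "poly_fun p differentiable (at x)"
    unfolding poly_fun_def [abs_def] by (auto intro!: differentiable_sum differentiable_mult)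
  then obtain F where F: "(poly_fun p has_derivative F) (at x)"
    unfolding differentiable_def by blast
  then have "linear F" by (rule has_derivative_linear)
  then have "F = (\<lambda>h. inner h (adjoint F 1))"
    using adjoint_works[of F _ 1] by (auto simp: inner_real_def)
  with F have "GDERIV (poly_fun p) x :> adjoint F 1"
    unfolding gderiv_def by simp
  then show ?thesis using gradient_eq by metis
qed

lemma poly_fun_superset:
  assumes "finite A" "Poly_Mapping.keys p \<subseteq> A"
  shows "poly_fun p x = (\<Sum>m\<in>A. Poly_Mapping.lookup p m * monom_fun m x)"
  unfolding poly_fun_def
  by (rule sum.mono_neutral_left) (use assms in \<open>auto simp: in_keys_iff\<close>)

lemma poly_fun_zero [simp]: "poly_fun 0 x = 0"
  by (simp add: poly_fun_def)

lemma poly_fun_add: "poly_fun (p + q) x = poly_fun p x + poly_fun q x"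
proof -
  let ?A = "Poly_Mapping.keys p \<union> Poly_Mapping.keys q"
  have "Poly_Mapping.keys (p + q) \<subseteq> ?A" by (rule keys_add)
  then show ?thesis
    by (simp add: poly_fun_superset[of ?A] lookup_add algebra_simps sum.distrib)
qed

lemma poly_fun_diff: "poly_fun (p - q) x = poly_fun p x - poly_fun q x"
  by (metis add_diff_cancel diff_add_cancel poly_fun_add)

lemma poly_fun_sum: "poly_fun (\<Sum>i\<in>A. p i) x = (\<Sum>i\<in>A. poly_fun (p i) x)"
  by (induction A rule: infinite_finite_induct) (auto simp: poly_fun_add)

lemma poly_fun_single: "poly_fun (Poly_Mapping.single m c) x = c * monom_fun m x"
  by (simp add: poly_fun_superset[of "{m}"])

lemma monom_fun_add: "monom_fun (m + k) x = monom_fun m x * monom_fun k x"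
  by (simp add: monom_fun_def lookup_add power_add prod.distrib)

lemma real_mpoly_induct [case_names zero single add]:
  fixes p :: "'n real_mpoly"
  assumes "P 0" "\<And>m c. P (Poly_Mapping.single m c)" "\<And>p q. P p \<Longrightarrow> P q \<Longrightarrow> P (p + q)"
  shows "P p"
proof -
  have "P (\<Sum>m\<in>A. Poly_Mapping.single m (Poly_Mapping.lookup p m))" for A
    by (induction A rule: infinite_finite_induct) (auto intro: assms)
  moreover have "(\<Sum>m\<in>Poly_Mapping.keys p. Poly_Mapping.single m (Poly_Mapping.lookup p m)) = p"
    by (rule poly_mapping_eqI)
       (auto simp: lookup_sum lookup_single when_def in_keys_iff sum.delta)
  ultimately show ?thesis by metis
qed

lemma poly_fun_mult: "poly_fun (p * q) x = poly_fun p x * poly_fun q x"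
proof (induction p rule: real_mpoly_induct)
  case (single m c)
  show ?case
    by (induction q rule: real_mpoly_induct)
       (auto simp: mult_single poly_fun_single monom_fun_add poly_fun_add algebra_simps)
qed (auto simp: poly_fun_add algebra_simps)

text \<open>The squared Euclidean norm is a polynomial function, and so is every function of the form
  \<open>f(x) (1 - c \<parallel>x\<parallel>\<^sup>2)\<close> with \<open>f\<close> a polynomial.\<close>

lemma poly_fun_form_times_sphere:
  "\<exists>g. \<forall>x. poly_fun g x = poly_fun f x * (1 - c * (norm x)\<^sup>2)"
proof -
  define s :: "'a real_mpoly" where
    "s = (\<Sum>i\<in>UNIV. Poly_Mapping.single (Poly_Mapping.single i 2) 1)"
  have "monom_fun (Poly_Mapping.single i 2) x = (x $ i)\<^sup>2" for i :: 'a and x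
  proof -
    have "monom_fun (Poly_Mapping.single i 2) x = (\<Prod>j\<in>UNIV. if j = i then (x $ i)\<^sup>2 else 1)"
      unfolding monom_fun_def by (rule prod.cong) (auto simp: lookup_single when_def)
    then show ?thesis by simp
  qed
  then have s: "poly_fun s x = (norm x)\<^sup>2" for x
    by (simp add: s_def poly_fun_sum poly_fun_single norm_vec_def L2_set_def sum_nonneg)
  have c: "poly_fun (Poly_Mapping.single 0 a) x = a" for a and x :: "real ^ 'a"
    by (simp add: poly_fun_single monom_fun_def)
  have "poly_fun (f * (Poly_Mapping.single 0 1 - Poly_Mapping.single 0 c * s)) x
      = poly_fun f x * (1 - c * (norm x)\<^sup>2)" for x
    by (simp only: poly_fun_mult poly_fun_diff s c)
  then show ?thesis by blast
qed

end

theory Submission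
  imports Defs
begin

text \<open>
  The proof rests on one identity and one orthogonality. At a unit vector \<open>x\<close> the product rule,
  with the constant \<open>d / (d + 2)\<close> chosen for this purpose, gives
  \<open>\<nabla>g(x) = 2 / (d + 2) *\<^sub>R r\<close> for the residual \<open>r = \<nabla>f(x) - (d f(x)) *\<^sub>R x\<close>
  (\<open>gradient_mult_damping\<close>). So \<open>x\<close> is critical for \<open>g\<close> exactly if \<open>r = 0\<close>.

  Euler's identity \<open>\<nabla>f(x) \<bullet> x = d f(x)\<close> (\<open>Euler_identity\<close>) says that \<open>(d f(x)) *\<^sub>R x\<close> is
  the component of \<open>\<nabla>f(x)\<close> along \<open>x\<close>, so \<open>r\<close> is the tangential component. By Pythagoras
  \<open>(norm r)\<^sup>2 = (norm (\<nabla>f(x)))\<^sup>2 - (d f(x))\<^sup>2\<close>, which settles the second equivalence; and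
  (FONC), which says that \<open>\<nabla>f(x)\<close> is a multiple of \<open>x\<close>, also says that \<open>r = 0\<close>.
\<close>

lemma monom_fun_scaleR:
  "monom_fun m (t *\<^sub>R x) = t ^ (\<Sum>i\<in>UNIV. Poly_Mapping.lookup m i) * monom_fun m x"
  by (simp add: monom_fun_def power_mult_distrib prod.distrib power_sum)

lemma poly_fun_form_scaleR:
  assumes "is_form d f"
  shows "poly_fun f (t *\<^sub>R x) = t ^ d * poly_fun f x"
proof -
  have "poly_fun f (t *\<^sub>R x)
      = (\<Sum>m\<in>Poly_Mapping.keys f. t ^ d * (Poly_Mapping.lookup f m * monom_fun m x))"
    unfolding poly_fun_def using assms
    by (intro sum.cong) (auto simp: monom_fun_scaleR is_form_def)
  then show ?thesis
    by (simp add: poly_fun_def sum_distrib_left)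
qed

text \<open>Both sides are the derivative at \<open>t = 1\<close> of \<open>t \<mapsto> f(t x) = t ^ d f(x)\<close>.\<close>

lemma Euler_identity:
  assumes "is_form d f"
  shows "gradient (poly_fun f) x \<bullet> x = real d * poly_fun f x"
proof -
  let ?G = "gradient (poly_fun f) x"
  have ray: "((\<lambda>t::real. t *\<^sub>R x) has_derivative (\<lambda>t. t *\<^sub>R x)) (at 1)"
    by (auto intro!: derivative_eq_intros)
  have "(poly_fun f has_derivative (\<lambda>h. h \<bullet> ?G)) (at (1 *\<^sub>R x))"
    using gderiv_poly_fun[of f x] by (simp add: gderiv_def)
  from has_derivative_compose[OF ray this]
  have "((\<lambda>t. t ^ d * poly_fun f x) has_derivative (\<lambda>t. (t *\<^sub>R x) \<bullet> ?G)) (at 1)"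
    by (simp add: poly_fun_form_scaleR[OF assms])
  then have "((\<lambda>t. t ^ d * poly_fun f x) has_real_derivative (?G \<bullet> x)) (at 1)"
    by (simp add: has_field_derivative_def inner_commute mult_commute_abs)
  moreover have "((\<lambda>t. t ^ d * poly_fun f x) has_real_derivative (real d * poly_fun f x)) (at 1)"
    by (auto intro!: derivative_eq_intros)
  ultimately show ?thesis
    by (rule DERIV_unique)
qed

lemma gradient_mult_damping:
  fixes x :: "'a::real_inner"
  assumes "GDERIV f x :> D" and "norm x = 1" and "d \<ge> 0"
  shows "gradient (\<lambda>y. f y * (1 - d / (d + 2) * (norm y)\<^sup>2)) x
    = (2 / (d + 2)) *\<^sub>R (D - (d * f x) *\<^sub>R x)"
proof (rule gradient_eq)
  let ?c = "d / (d + 2)"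
  have sphere: "x \<bullet> x = 1"
    using assms(2) by (simp add: dot_square_norm)
  have damp: "1 - ?c = 2 / (d + 2)"
    using assms(3) by (simp add: field_simps)
  have f: "(f has_derivative (\<lambda>h. h \<bullet> D)) (at x)"
    using assms(1) by (simp add: gderiv_def)
  have "((\<lambda>y. f y * (1 - ?c * (y \<bullet> y))) has_derivative
      (\<lambda>h. f x * (- (?c * (x \<bullet> h + h \<bullet> x))) + (h \<bullet> D) * (1 - ?c * (x \<bullet> x)))) (at x)"
    by (rule derivative_eq_intros f refl | simp)+
  moreover have "(\<lambda>h. f x * (- (?c * (x \<bullet> h + h \<bullet> x))) + (h \<bullet> D) * (1 - ?c * (x \<bullet> x)))
      = (\<lambda>h. h \<bullet> ((2 / (d + 2)) *\<^sub>R (D - (d * f x) *\<^sub>R x)))"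
    unfolding sphere mult_1_right damp
    by (simp add: fun_eq_iff inner_diff_right inner_commute algebra_simps)
  ultimately show "GDERIV (\<lambda>y. f y * (1 - ?c * (norm y)\<^sup>2)) x
      :> (2 / (d + 2)) *\<^sub>R (D - (d * f x) *\<^sub>R x)"
    by (simp add: gderiv_def power2_norm_eq_inner)
qed

text \<open>For a unit vector \<open>x\<close>, \<open>v - (v \<bullet> x) *\<^sub>R x\<close> is the component of \<open>v\<close> orthogonal to \<open>x\<close>;
  Pythagoras computes its length.\<close>

lemma eq_projection_iff_norm:
  fixes v x :: "'a::real_inner"
  assumes "norm x = 1"
  shows "v = (v \<bullet> x) *\<^sub>R x \<longleftrightarrow> (norm v)\<^sup>2 = (v \<bullet> x)\<^sup>2"
proof -
  have "x \<bullet> x = 1"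
    using assms by (simp add: dot_square_norm)
  then have pythagoras: "(norm (v - (v \<bullet> x) *\<^sub>R x))\<^sup>2 = (norm v)\<^sup>2 - (v \<bullet> x)\<^sup>2"
    unfolding power2_norm_eq_inner
    by (simp add: inner_diff_left inner_diff_right inner_commute power2_eq_square)
  have "v = (v \<bullet> x) *\<^sub>R x \<longleftrightarrow> (norm (v - (v \<bullet> x) *\<^sub>R x))\<^sup>2 = 0"
    by simp
  then show ?thesis
    unfolding pythagoras by simp
qed

text \<open>The multiplier is forced: taking the inner product of (FONC) with the unit vector \<open>x\<close>
  gives \<open>\<nabla>f(x) \<bullet> x = - 2 * l\<close>.\<close>

lemma fonc_iff_eq_projection:
  fixes x :: "'a::real_inner"
  assumes "norm x = 1"
  shows "fonc f x \<longleftrightarrow> gradient f x = (gradient f x \<bullet> x) *\<^sub>R x"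
proof
  assume "fonc f x"
  then obtain l where l: "gradient f x = (- 2 * l) *\<^sub>R x"
    by (auto simp: fonc_def add_eq_0_iff2)
  then have "gradient f x \<bullet> x = - 2 * l"
    using assms by (simp add: dot_square_norm)
  with l show "gradient f x = (gradient f x \<bullet> x) *\<^sub>R x"
    by simp
next
  assume eq: "gradient f x = (gradient f x \<bullet> x) *\<^sub>R x"
  have "gradient f x + (2 * (- (gradient f x \<bullet> x) / 2)) *\<^sub>R x = 0"
    using eq by simp
  then show "fonc f x"
    unfolding fonc_def by blast
qed

theorem proposition3p2:
  fixes f g :: "'n::finite real_mpoly" and d :: nat
  assumes "d \<ge> 1"
    and "is_form d f"
    and "\<forall>x. poly_fun g x = poly_fun f x * (1 - real d / (real d + 2) * (norm x)\<^sup>2)"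
  shows "\<forall>x \<in> sphere 0 1.
      (gradient (poly_fun g) x = 0 \<longleftrightarrow>
         gradient (poly_fun f) x = (real d * poly_fun f x) *\<^sub>R x) \<and>
      (gradient (poly_fun f) x = (real d * poly_fun f x) *\<^sub>R x \<longleftrightarrow>
         (norm (gradient (poly_fun f) x))\<^sup>2 = (real d * poly_fun f x)\<^sup>2) \<and>
      (gradient (poly_fun g) x = 0 \<longleftrightarrow> fonc (poly_fun f) x)"
proof
  fix x :: "real ^ 'n"
  assume "x \<in> sphere 0 1"
  then have x: "norm x = 1"
    by simp
  have g: "poly_fun g = (\<lambda>y. poly_fun f y * (1 - real d / (real d + 2) * (norm y)\<^sup>2))"
    using assms(3) by blast
  have "gradient (poly_fun g) x
      = (2 / (real d + 2)) *\<^sub>R (gradient (poly_fun f) x - (real d * poly_fun f x) *\<^sub>R x)"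
    unfolding g using x by (intro gradient_mult_damping gderiv_poly_fun) simp_all
  then have "gradient (poly_fun g) x = 0 \<longleftrightarrow>
      gradient (poly_fun f) x = (real d * poly_fun f x) *\<^sub>R x"
    by (simp add: add_nonneg_eq_0_iff)
  then show "(gradient (poly_fun g) x = 0 \<longleftrightarrow>
         gradient (poly_fun f) x = (real d * poly_fun f x) *\<^sub>R x) \<and>
      (gradient (poly_fun f) x = (real d * poly_fun f x) *\<^sub>R x \<longleftrightarrow>
         (norm (gradient (poly_fun f) x))\<^sup>2 = (real d * poly_fun f x)\<^sup>2) \<and>
      (gradient (poly_fun g) x = 0 \<longleftrightarrow> fonc (poly_fun f) x)"
    using eq_projection_iff_norm[OF x, of "gradient (poly_fun f) x"]
      fonc_iff_eq_projection[OF x, of "poly_fun f"]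
    unfolding Euler_identity[OF assms(2)] by blast
qed

end
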